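(* Let $(X,\mathrm{dist})$ be a metric space, $z\ge1$, $k\ge1$ an integer, $c\in X$, $r>0$, $0<\varepsilon<1$, and let $R\subseteq\mathrm{ring}(c,r,2r)$ be finite. Suppose there is a family of functions $\mathcal{F}=\{f_x:X\to\mathbb{R}_{\ge0}\}_{x\in R}$ such that $\mathrm{dist}(x,y)\le f_x(y)\le(1+\varepsilon)\mathrm{dist}(x,y)$ for all $x\in R$, $y\in X$. Then for every $0<\delta<1$, a uniform sample $S\subseteq R$ of size $\tilde O_z(\varepsilon^{-2})\cdot k\log\delta^{-1}\cdot\mathrm{sdim}(\mathcal{F})$, with each $p\in S$ re-weighted by $w_S(p)=|R|/|S|$, is an $(\varepsilon,\mathrm{cost}_z(R,c))$-coreset for $(k,z)$-Clustering on $R$ with probability at least $1-\delta$.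
   Context: $\mathrm{ring}(c,a,b)=\{x\in X:a<\mathrm{dist}(x,c)\le b\}$. For a finite weighted set $Q$ (unit weights if unweighted) and finite $C\subseteq X$, $\mathrm{cost}_z(Q,C)=\sum_{x\in Q}w_Q(x)\min_{u\in C}\mathrm{dist}(x,u)^z$, and $\mathrm{cost}_z(Q,c)=\mathrm{cost}_z(Q,\{c\})$. A weighted set $S$ is an $(\varepsilon,A)$-coreset for $(k,z)$-Clustering on $R$ if for every $C\subseteq X$ with $|C|\le k$, $|\mathrm{cost}_z(R,C)-\mathrm{cost}_z(S,C)|\le\varepsilon(\mathrm{cost}_z(R,C)+A)$. Shattering dimension: for a family $\mathcal{F}=\{f_x:X\to\mathbb{R}_{\ge0}\}$, $y\in X$, $\rho\ge0$, let $B_{\mathcal{F}}(y,\rho)=\{f_x\in\mathcal{F}:f_x(y)\le\rho\}$. $\mathrm{sdim}(\mathcal{F})$ is the smallest integer $s\ge1$ such that for every $\mathcal{H}\subseteq\mathcal{F}$ with $|\mathcal{H}|\ge2$, $|\{B_{\mathcal{F}}(y,\rho)\cap\mathcal{H}:y\in X,\rho\ge0\}|\le|\mathcal{H}|^s$. $\tilde O_z$ hides factors depending only on $z$ and polylogarithmic factors.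
   Formalization: As stated this fails for z>1 and as δ→1; proved: an (Γε, cost_z(R,c))-coreset, Γ depending only on z (Γ=1 if z=1), log δ^{-1} read as max(1, ln δ^{-1}), polylog in k·sdim/ε, R nonempty, i.i.d. draws, spaces X within one arbitrary carrier type. *)

theory Defs
  imports "HOL-Analysis.Analysis" "HOL-Probability.Probability"
begin

definition ring_in :: "'a set \<Rightarrow> ('a \<Rightarrow> 'a \<Rightarrow> real) \<Rightarrow> 'a \<Rightarrow> real \<Rightarrow> real \<Rightarrow> 'a set" where
  "ring_in X d c a b = {x \<in> X. a < d x c \<and> d x c \<le> b}"

(* A weighted set is a finite set Q together with a weight function w. *)
definition cost :: "('a \<Rightarrow> 'a \<Rightarrow> real) \<Rightarrow> real \<Rightarrow> 'a set \<Rightarrow> ('a \<Rightarrow> real) \<Rightarrow> 'a set \<Rightarrow> real" where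
  "cost d z Q w C = (\<Sum>x\<in>Q. w x * Min ((\<lambda>u. d x u powr z) ` C))"

abbreviation unit_weight :: "'a \<Rightarrow> real" where
  "unit_weight \<equiv> (\<lambda>_. 1)"

(* The center set C must be nonempty, since min over the empty set is undefined. *)
definition is_coreset ::
  "'a set \<Rightarrow> ('a \<Rightarrow> 'a \<Rightarrow> real) \<Rightarrow> nat \<Rightarrow> real \<Rightarrow> real \<Rightarrow> real \<Rightarrow> 'a set \<Rightarrow> 'a set \<Rightarrow> ('a \<Rightarrow> real) \<Rightarrow> bool"
where
  "is_coreset X d k z \<epsilon> A R S w \<longleftrightarrow>
     (\<forall>C. C \<subseteq> X \<and> finite C \<and> C \<noteq> {} \<and> card C \<le> k \<longrightarrow>
        \<bar>cost d z R unit_weight C - cost d z S w C\<bar> \<le> \<epsilon> * (cost d z R unit_weight C + A))"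

definition fball :: "('a \<Rightarrow> real) set \<Rightarrow> 'a \<Rightarrow> real \<Rightarrow> ('a \<Rightarrow> real) set" where
  "fball F y \<rho> = {g \<in> F. g y \<le> \<rho>}"

(* Meant for finite F, where such an s always exists and every H is finite. *)
definition sdim :: "'a set \<Rightarrow> ('a \<Rightarrow> real) set \<Rightarrow> nat" where
  "sdim X F = (LEAST s. 1 \<le> s \<and>
     (\<forall>H. H \<subseteq> F \<and> 2 \<le> card H \<longrightarrow>
        card {fball F y \<rho> \<inter> H | y \<rho>. y \<in> X \<and> 0 \<le> \<rho>} \<le> card H ^ s))"

(* A sample is the list of its independent draws: it has size length xs, and every draw
   carries weight |R| / length xs, so a point drawn several times accumulates weight. *)
definition sample_weight :: "'a set \<Rightarrow> 'a list \<Rightarrow> 'a \<Rightarrow> real" where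
  "sample_weight R xs p = real (count_list xs p) * (real (card R) / real (length xs))"

(* The sample size (1/eps^2) * k * log(1/delta) * s, up to K and a polylogarithmic factor of
   exponent p.  The logarithm of s must be included in the latter: with all 2^n subsets of R
   cut out by balls, s is about n / log n, while a sample of order n is necessary.
   log(1/delta) is read as at least 1; otherwise the size would tend to 0 as delta tends to 1. *)
definition sample_size :: "real \<Rightarrow> nat \<Rightarrow> real \<Rightarrow> real \<Rightarrow> nat \<Rightarrow> nat \<Rightarrow> real" where
  "sample_size K p \<epsilon> \<delta> k s =
     K * (1 + ln (real k * real s / \<epsilon>)) ^ p * (1 / \<epsilon>\<^sup>2) * real k * max 1 (ln (1 / \<delta>)) * real s"

(* The theorem has accuracy \<Gamma> * \<epsilon> with \<Gamma> depending only on z, and \<Gamma> = 1 for z = 1.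
   For z > 1 such a factor is unavoidable, as f x only approximates d x up to 1 + \<epsilon>, hence
   its z-th power up to (1 + \<epsilon>)^z.  Example with k = 1, z = 2, \<epsilon> = 1/10, r = 1: R has n points at
   mutual distance 1 and at distance 2 from c; for every T \<subseteq> R there is a point u_T at
   distance 4 from T, 4.4 from R - T, 4 from c and 1 from the other u's.  Put f x u_T = 4.4 for
   all x and T, and f = d elsewhere; then sdim = 2.  If T is the set of sampled points and n is
   large compared to the sample size, the costs of R and S with respect to u_T are about 19.36 n
   and 16 n, and their difference exceeds \<epsilon> (19.36 n + 4 n). *)

end

theory Submission
  imports Defs
begin

text \<open>
  For a center set C put g x = (min over u in C of f x u) powr z. A sublevel set of g is a union of
  at most k balls of the family f, so at most (2m) ^ (s k) such sets are distinguishable on 2m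
  points, s being the shattering dimension. Comparing the sample with an independent second one
  (Jensen's inequality for the exponential function) and exchanging the two samples coordinatewise
  shows that, except with probability 2 (2m) ^ (s k) exp (- m \<eta>^2 / 2), all sublevel sets are
  represented in the sample up to an error \<eta> = \<epsilon> / 12.

  By the layer-cake formula, the averages of g over R and over the sample then differ by at most
  \<eta> times the length of an interval containing the values of g. If E is the distance from c to C,
  all distances to C lie in [E - 2r, E + 2r]; hence this length is of the order of the average cost
  with respect to C plus that with respect to c. For z = 1, where no constant may be lost, the
  values of g lie in an interval of length 12 r unless \<epsilon> E \<ge> 6 r, and in the latter case the
  claim is trivial, as the distances vary by at most 4 r.
\<close>

subsection \<open>Uniform deviation bounds by symmetrization\<close>

definition lists_of_length :: "'a set \<Rightarrow> nat \<Rightarrow> 'a list set" where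
  "lists_of_length R n = {xs. set xs \<subseteq> R \<and> length xs = n}"

definition hits :: "'a set \<Rightarrow> 'a list \<Rightarrow> real" where
  "hits T xs = (\<Sum>x\<leftarrow>xs. indicat_real T x)"

lemma hits_Nil [simp]: "hits T [] = 0"
  and hits_Cons [simp]: "hits T (x # xs) = indicat_real T x + hits T xs"
  by (simp_all add: hits_def)

lemma lists_of_length_0 [simp]: "lists_of_length R 0 = {[]}"
  by (auto simp: lists_of_length_def)

lemma finite_lists_of_length [simp]: "finite R \<Longrightarrow> finite (lists_of_length R n)"
  by (simp add: lists_of_length_def finite_lists_length_eq)

lemma card_lists_of_length: "finite R \<Longrightarrow> card (lists_of_length R n) = card R ^ n"
  by (simp add: lists_of_length_def card_lists_length_eq)

lemma sum_lists_of_length_Suc: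
  "(\<Sum>xs\<in>lists_of_length R (Suc n). g xs) = (\<Sum>x\<in>R. \<Sum>xs\<in>lists_of_length R n. g (x # xs))"
proof -
  have "bij_betw (\<lambda>(x, xs). x # xs) (R \<times> lists_of_length R n) (lists_of_length R (Suc n))"
    by (rule bij_betwI[where g = "\<lambda>xs. (hd xs, tl xs)"])
       (auto simp: lists_of_length_def length_Suc_conv)
  from sum.reindex_bij_betw[OF this, of g, symmetric] show ?thesis
    by (simp add: sum.cartesian_product case_prod_unfold)
qed

text \<open>Prepending an independent uniform draw is a uniform choice from a product, carried over
  injectively to longer lists. Probabilities of samples thereby become counts, and all later
  estimates are inequalities between finite sums.\<close>

lemma replicate_pmf_of_set:
  assumes "finite R" "R \<noteq> {}"
  shows "replicate_pmf n (pmf_of_set R) = pmf_of_set (lists_of_length R n)"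
proof (induction n)
  case 0
  show ?case by (simp add: pmf_of_set_singleton)
next
  case (Suc n)
  have ne: "lists_of_length R n \<noteq> {}"
    using assms card_lists_of_length[of R n] by (metis card.empty card_0_eq power_not_zero)
  have "replicate_pmf (Suc n) (pmf_of_set R) =
      map_pmf (\<lambda>(x, xs). x # xs) (pair_pmf (pmf_of_set R) (pmf_of_set (lists_of_length R n)))"
    by (simp add: Suc pair_pmf_def map_bind_pmf bind_return_pmf map_pmf_def bind_assoc_pmf)
  also have "pair_pmf (pmf_of_set R) (pmf_of_set (lists_of_length R n))
      = pmf_of_set (R \<times> lists_of_length R n)"
  proof (rule pmf_eqI)
    fix y
    have "R \<times> lists_of_length R n \<noteq> {}" using assms ne by simp
    thus "pmf (pair_pmf (pmf_of_set R) (pmf_of_set (lists_of_length R n))) y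
        = pmf (pmf_of_set (R \<times> lists_of_length R n)) y"
      using assms ne
      by (cases y) (simp add: pmf_pair card_cartesian_product indicator_times del: Times_empty)
  qed
  also have "map_pmf (\<lambda>(x, xs). x # xs) \<dots> = pmf_of_set ((\<lambda>(x, xs). x # xs) ` (R \<times> lists_of_length R n))"
    using assms ne by (intro map_pmf_of_set_inj) (auto simp: inj_on_def)
  also have "(\<lambda>(x, xs). x # xs) ` (R \<times> lists_of_length R n) = lists_of_length R (Suc n)"
    by (force simp: lists_of_length_def length_Suc_conv)
  finally show ?case .
qed

section \<open>Exponential moments and comparison with a second sample\<close>

text \<open>The left side is the moment generating function of a fair sign. The bound is the
  auxiliary inequality of Hoeffding's lemma at \<open>2 * l\<close> and \<open>p = 1 / 2\<close>,
  since \<open>cosh l\<close> equals \<open>exp (-l)\<close> times the mean of 1 and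
  \<open>exp (2 * l)\<close>; evenness covers negative \<open>l\<close>.\<close>

lemma cosh_le_exp_half_square: "cosh (l::real) \<le> exp (l\<^sup>2 / 2)"
proof -
  have *: "cosh l \<le> exp (l\<^sup>2 / 2)" if "l \<ge> 0" for l :: real
  proof -
    have "- l + ln ((1 + exp (2 * l)) / 2) \<le> l\<^sup>2 / 2"
      using Hoeffdings_lemma_aux[of "2 * l" "1 / 2"] that
      by (simp add: power_mult_distrib field_simps)
    hence "ln ((1 + exp (2 * l)) / 2) \<le> l + l\<^sup>2 / 2" by simp
    hence "exp (ln ((1 + exp (2 * l)) / 2)) \<le> exp (l + l\<^sup>2 / 2)" by simp
    hence "(1 + exp (2 * l)) / 2 \<le> exp (l + l\<^sup>2 / 2)" by (simp add: add_pos_pos)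
    hence "exp (-l) * ((1 + exp (2 * l)) / 2) \<le> exp (-l) * exp (l + l\<^sup>2 / 2)"
      by (intro mult_left_mono) auto
    also have "\<dots> = exp (l\<^sup>2 / 2)" by (simp flip: exp_add)
    also have "exp (-l) * ((1 + exp (2 * l)) / 2) = cosh l"
      by (simp add: cosh_field_def field_simps flip: exp_add)
    finally show ?thesis .
  qed
  show ?thesis using *[of l] *[of "-l"] by (cases "l \<ge> 0") auto
qed

text \<open>Exchanging the i-th entries of xs and ys does not change the union of the two sets, so each
  factor may be averaged over the two orders, which makes it 1 or cosh l.\<close>
lemma sum_exp_hits_diff_le:
  assumes "finite R" "\<And>U. h U \<ge> 0"
  shows "(\<Sum>xs\<in>lists_of_length R m. \<Sum>ys\<in>lists_of_length R m.
            h (set xs \<union> set ys) * exp (l * (hits T xs - hits T ys)))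
       \<le> exp (l\<^sup>2 / 2) ^ m *
          (\<Sum>xs\<in>lists_of_length R m. \<Sum>ys\<in>lists_of_length R m. h (set xs \<union> set ys))"
  using assms(2)
\<comment> \<open>\<open>h\<close> must vary: once the first entries \<open>x\<close>,
  \<open>y\<close> are split off, the hypothesis is applied to the weight that sends
  \<open>U\<close> to \<open>h ({x, y} \<union> U)\<close>.\<close>
proof (induction m arbitrary: h)
  case 0
  show ?case by simp
next
  case (Suc m)
  define e where "e x y = exp (l * (indicat_real T x - indicat_real T y))" for x y
  define c where "c = exp (l\<^sup>2 / 2)"
  let ?L = "lists_of_length R m"
  have e: "e x y + e y x \<le> 2 * c" for x y
  proof -
    have "1 \<le> c" by (simp add: c_def)
    moreover have "exp l + exp (- l) \<le> 2 * c"
      using cosh_le_exp_half_square[of l] by (simp add: cosh_field_def c_def)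
    ultimately show ?thesis by (auto simp: e_def indicator_def)
  qed
  define H where "H x y = (\<Sum>xs\<in>?L. \<Sum>ys\<in>?L. h ({x, y} \<union> (set xs \<union> set ys)))" for x y
  have H: "H x y = H y x" "H x y \<ge> 0" for x y
    using Suc.prems by (auto simp: H_def insert_commute intro!: sum_nonneg)
  have swap: "(\<Sum>xs\<in>lists_of_length R (Suc m). \<Sum>ys\<in>lists_of_length R (Suc m). G xs ys) =
      (\<Sum>x\<in>R. \<Sum>y\<in>R. \<Sum>xs\<in>?L. \<Sum>ys\<in>?L. G (x # xs) (y # ys))" for G :: "'a list \<Rightarrow> 'a list \<Rightarrow> real"
    by (subst sum_lists_of_length_Suc, subst sum_lists_of_length_Suc)
       (rule sum.cong[OF refl], rule sum.swap)
  have U: "set (x # xs) \<union> set (y # ys) = {x, y} \<union> (set xs \<union> set ys)" for x y and xs ys :: "'a list"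
    by auto
  have "(\<Sum>xs\<in>lists_of_length R (Suc m). \<Sum>ys\<in>lists_of_length R (Suc m).
            h (set xs \<union> set ys) * exp (l * (hits T xs - hits T ys)))
      = (\<Sum>x\<in>R. \<Sum>y\<in>R. e x y * (\<Sum>xs\<in>?L. \<Sum>ys\<in>?L.
            h ({x, y} \<union> (set xs \<union> set ys)) * exp (l * (hits T xs - hits T ys))))"
    unfolding swap U
    by (simp add: e_def sum_distrib_left algebra_simps exp_add exp_diff)
  also have "\<dots> \<le> (\<Sum>x\<in>R. \<Sum>y\<in>R. e x y * (c ^ m * H x y))"
    unfolding H_def c_def
    using Suc.IH[of "\<lambda>U. h ({_, _} \<union> U)"] Suc.prems
    by (intro sum_mono mult_left_mono) (auto simp: e_def)
  also have "\<dots> = c ^ m * ((\<Sum>x\<in>R. \<Sum>y\<in>R. e x y * H x y))"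
    by (simp add: sum_distrib_left mult_ac)
  also have "(\<Sum>x\<in>R. \<Sum>y\<in>R. e x y * H x y)
      = ((\<Sum>x\<in>R. \<Sum>y\<in>R. e x y * H x y) + (\<Sum>x\<in>R. \<Sum>y\<in>R. e y x * H x y)) / 2"
    using sum.swap[of "\<lambda>x y. e y x * H x y" R R] H(1) by simp
  also have "\<dots> = (\<Sum>x\<in>R. \<Sum>y\<in>R. (e x y + e y x) * H x y) / 2"
    by (simp add: sum.distrib algebra_simps)
  also have "\<dots> \<le> (\<Sum>x\<in>R. \<Sum>y\<in>R. (2 * c) * H x y) / 2"
    by (intro divide_right_mono sum_mono mult_right_mono e H) auto
  also have "\<dots> = c * (\<Sum>x\<in>R. \<Sum>y\<in>R. H x y)"
    by (simp add: mult.assoc flip: sum_distrib_left)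
  finally show ?case
    unfolding swap U by (simp add: c_def H_def mult_left_mono mult_ac)
qed

text \<open>Jensen's inequality in unnormalized form; independence makes it a product over the
  draws. It allows the expected number of hits to be replaced by the hits of a second sample inside
  an exponential, for either sign of \<open>l\<close>.\<close>

lemma exp_mean_le_sum_exp_hits:
  fixes l :: real
  assumes "finite R" "R \<noteq> {}" "A \<subseteq> R"
  defines "q \<equiv> real (card A) / real (card R)"
  shows "real (card R) ^ m * exp (l * (real m * q)) \<le> (\<Sum>ys\<in>lists_of_length R m. exp (l * hits A ys))"
proof (induction m)
  case 0
  show ?case by simp
next
  case (Suc m)
  have n: "real (card R) > 0" using assms by (simp add: card_gt_0_iff)
  have i: "(\<Sum>y\<in>R. indicat_real A y) = real (card A)"
    using assms by (simp add: indicator_def sum.If_cases Int_absorb1)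
  \<comment> \<open>The tangent of the exponential function at the mean \<open>q\<close>: its linear
    part sums to zero over \<open>R\<close>.\<close>
  have "real (card R) * exp (l * q) = exp (l * q) * (\<Sum>y\<in>R. 1 + l * (indicat_real A y - q))"
    using n by (simp add: sum.distrib sum_subtractf i q_def flip: sum_distrib_left)
  also have "\<dots> = (\<Sum>y\<in>R. exp (l * q) * (1 + l * (indicat_real A y - q)))"
    by (simp add: sum_distrib_left)
  also have "\<dots> \<le> (\<Sum>y\<in>R. exp (l * q) * exp (l * (indicat_real A y - q)))"
    by (intro sum_mono mult_left_mono exp_ge_add_one_self) auto
  also have "\<dots> = (\<Sum>y\<in>R. exp (l * indicat_real A y))"
    by (simp add: algebra_simps flip: exp_add)
  finally have 1: "real (card R) * exp (l * q) \<le> (\<Sum>y\<in>R. exp (l * indicat_real A y))" .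
  have "real (card R) ^ Suc m * exp (l * (real (Suc m) * q))
      = (real (card R) * exp (l * q)) * (real (card R) ^ m * exp (l * (real m * q)))"
    by (simp add: algebra_simps exp_add)
  also have "\<dots> \<le> (\<Sum>y\<in>R. exp (l * indicat_real A y)) * (\<Sum>ys\<in>lists_of_length R m. exp (l * hits A ys))"
    by (intro mult_mono 1 Suc) (auto intro!: sum_nonneg mult_nonneg_nonneg)
  also have "\<dots> = (\<Sum>ys\<in>lists_of_length R (Suc m). exp (l * hits A ys))"
    by (simp add: sum_lists_of_length_Suc sum_product algebra_simps exp_add)
  finally show ?case .
qed

lemma hits_Int: "set xs \<subseteq> U \<Longrightarrow> hits (A \<inter> U) xs = hits A xs"
  by (induction xs) (auto simp: indicator_def)

text \<open>Markov's inequality for an exponential moment, with the mean replaced by a second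
  sample. Both samples see at most \<open>2 * m\<close> points, so the union bound runs over traces
  there and not over all of \<open>\<A>\<close>. The sign of \<open>l\<close> selects the side of
  the deviation.\<close>

lemma prob_exists_large_deviation_le:
  fixes l t :: real and \<A> :: "'a set set"
  assumes R: "finite R" "R \<noteq> {}" and A: "\<And>A. A \<in> \<A> \<Longrightarrow> A \<subseteq> R"
    and traces: "\<And>U. U \<subseteq> R \<Longrightarrow> U \<noteq> {} \<Longrightarrow> card U \<le> 2 * m \<Longrightarrow> real (card ((\<lambda>A. A \<inter> U) ` \<A>)) \<le> P"
    and m: "m \<ge> 1"
  shows "measure_pmf.prob (replicate_pmf m (pmf_of_set R))
     {xs. \<exists>A\<in>\<A>. t \<le> l * (hits A xs - real m * (real (card A) / real (card R)))}
     \<le> P * exp (l\<^sup>2 / 2 * real m - t)"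
proof -
  let ?L = "lists_of_length R m"
  define n where "n = real (card R)"
  have n: "n > 0" using R by (simp add: n_def card_gt_0_iff)
  define B where "B = {xs. \<exists>A\<in>\<A>. t \<le> l * (hits A xs - real m * (real (card A) / real (card R)))}"
  define tr where "tr U = (\<lambda>A. A \<inter> U) ` \<A>" for U
  have finA: "finite \<A>" using A R by (meson finite_Pow_iff finite_subset PowI subsetI)
  hence fin_tr: "finite (tr U)" for U by (simp add: tr_def)
  define E where "E T xs ys = exp (l * (hits T xs - hits T ys))" for T and xs ys :: "'a list"
  have key: "exp t * n ^ m \<le> (\<Sum>ys\<in>?L. \<Sum>T\<in>tr (set xs \<union> set ys). E T xs ys)"
    if xs: "xs \<in> ?L \<inter> B" for xs
  proof -
    from xs obtain A where A': "A \<in> \<A>" and t: "t \<le> l * (hits A xs - real m * (real (card A) / n))"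
      by (auto simp: B_def n_def)
    have "exp t * n ^ m \<le> exp (l * (hits A xs - real m * (real (card A) / n))) * n ^ m"
      using t n by (intro mult_right_mono) auto
    also have "\<dots> = exp (l * hits A xs) * (n ^ m * exp ((- l) * (real m * (real (card A) / n))))"
      by (simp add: algebra_simps flip: exp_add)
    \<comment> \<open>Jensen is used with \<open>- l\<close>, as the mean enters with the opposite
      sign.\<close>
    also have "\<dots> \<le> exp (l * hits A xs) * (\<Sum>ys\<in>?L. exp ((- l) * hits A ys))"
      unfolding n_def by (intro mult_left_mono exp_mean_le_sum_exp_hits R A A') auto
    also have "\<dots> = (\<Sum>ys\<in>?L. E A xs ys)"
      by (simp add: E_def sum_distrib_left algebra_simps flip: exp_add)
    also have "\<dots> = (\<Sum>ys\<in>?L. E (A \<inter> (set xs \<union> set ys)) xs ys)"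
      by (simp add: E_def hits_Int)
    also have "\<dots> \<le> (\<Sum>ys\<in>?L. \<Sum>T\<in>tr (set xs \<union> set ys). E T xs ys)"
      using A' fin_tr by (intro sum_mono member_le_sum) (auto simp: E_def tr_def)
    finally show ?thesis .
  qed
  have trR: "tr U \<subseteq> Pow R" for U using A by (auto simp: tr_def)
  have "real (card (?L \<inter> B)) * (exp t * n ^ m) = (\<Sum>xs\<in>?L \<inter> B. exp t * n ^ m)"
    by simp
  also have "\<dots> \<le> (\<Sum>xs\<in>?L \<inter> B. \<Sum>ys\<in>?L. \<Sum>T\<in>tr (set xs \<union> set ys). E T xs ys)"
    by (intro sum_mono key)
  also have "\<dots> \<le> (\<Sum>xs\<in>?L. \<Sum>ys\<in>?L. \<Sum>T\<in>tr (set xs \<union> set ys). E T xs ys)"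
    using R by (intro sum_mono2) (auto intro!: sum_nonneg simp: E_def)
  \<comment> \<open>The range of \<open>T\<close> depends on the samples. Encoding it as a 0-1
    weight over the fixed set \<open>Pow R\<close> lets the sums be exchanged; the weight depends
    only on the union of both samples, as \<open>sum_exp_hits_diff_le\<close> demands.\<close>
  also have "\<dots> = (\<Sum>xs\<in>?L. \<Sum>ys\<in>?L. \<Sum>T\<in>Pow R. of_bool (T \<in> tr (set xs \<union> set ys)) * E T xs ys)"
    using R trR by (intro sum.cong refl sum.mono_neutral_cong_left) auto
  also have "\<dots> = (\<Sum>T\<in>Pow R. \<Sum>xs\<in>?L. \<Sum>ys\<in>?L. of_bool (T \<in> tr (set xs \<union> set ys)) * E T xs ys)"
    by (subst sum.swap, subst (2) sum.swap) (simp add: sum.swap[of _ "Pow R"])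
  also have "\<dots> \<le> (\<Sum>T\<in>Pow R. exp (l\<^sup>2 / 2) ^ m * (\<Sum>xs\<in>?L. \<Sum>ys\<in>?L. of_bool (T \<in> tr (set xs \<union> set ys))))"
    unfolding E_def using R by (intro sum_mono sum_exp_hits_diff_le) auto
  also have "\<dots> = exp (l\<^sup>2 / 2) ^ m * (\<Sum>xs\<in>?L. \<Sum>ys\<in>?L. \<Sum>T\<in>Pow R. of_bool (T \<in> tr (set xs \<union> set ys)))"
    by (subst (2) sum.swap) (simp add: sum.swap[of _ "Pow R"] sum_distrib_left)
  also have "\<dots> = exp (l\<^sup>2 / 2) ^ m * (\<Sum>xs\<in>?L. \<Sum>ys\<in>?L. real (card (tr (set xs \<union> set ys))))"
    using R trR by (simp add: of_bool_def sum.If_cases Int_absorb1)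
  also have "\<dots> \<le> exp (l\<^sup>2 / 2) ^ m * (\<Sum>xs\<in>?L. \<Sum>ys\<in>?L. P)"
  proof (intro mult_left_mono sum_mono)
    fix xs ys assume *: "xs \<in> ?L" "ys \<in> ?L"
    have "card (set xs \<union> set ys) \<le> card (set xs) + card (set ys)" by (rule card_Un_le)
    also have "\<dots> \<le> 2 * m"
      using * card_length[of xs] card_length[of ys] by (simp add: lists_of_length_def)
    finally show "real (card (tr (set xs \<union> set ys))) \<le> P"
      unfolding tr_def using * m by (intro traces) (auto simp: lists_of_length_def)
  qed auto
  also have "\<dots> = exp (l\<^sup>2 / 2 * real m) * P * n ^ m * n ^ m"
    using R by (simp add: card_lists_of_length n_def mult_ac flip: exp_of_nat_mult)
  finally have "real (card (?L \<inter> B)) * exp t \<le> exp (l\<^sup>2 / 2 * real m) * P * n ^ m"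
    using n by simp
  hence "real (card (?L \<inter> B)) / n ^ m \<le> P * (exp (l\<^sup>2 / 2 * real m) / exp t)"
    using n by (simp add: divide_simps mult_ac)
  hence "real (card (?L \<inter> B)) / n ^ m \<le> P * exp (l\<^sup>2 / 2 * real m - t)"
    by (simp add: exp_diff)
  moreover have "?L \<noteq> {}"
    using R card_lists_of_length[of R m] by (metis card.empty card_0_eq power_not_zero)
  ultimately show ?thesis
    using R by (simp add: replicate_pmf_of_set measure_pmf_of_set card_lists_of_length n_def B_def)
qed

subsection \<open>Unions of balls and the shattering dimension\<close>

text \<open>\<open>LEAST\<close> is meaningful only if some exponent works. For finite
  \<open>F\<close> the exponent \<open>max 1 (card F)\<close> does, because
  \<open>2 ^ card H \<le> card H ^ card H\<close> once \<open>H\<close> has two elements.\<close>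

lemma sdim_props:
  assumes "finite F"
  shows sdim_ge_1: "1 \<le> sdim X F"
    and card_fball_traces_le: "\<And>H. H \<subseteq> F \<Longrightarrow> 2 \<le> card H \<Longrightarrow>
        card {fball F y \<rho> \<inter> H | y \<rho>. y \<in> X \<and> 0 \<le> \<rho>} \<le> card H ^ sdim X F"
proof -
  have "1 \<le> max 1 (card F) \<and> (\<forall>H. H \<subseteq> F \<and> 2 \<le> card H \<longrightarrow>
        card {fball F y \<rho> \<inter> H | y \<rho>. y \<in> X \<and> 0 \<le> \<rho>} \<le> card H ^ max 1 (card F))"
  proof (intro conjI allI impI)
    fix H assume H: "H \<subseteq> F \<and> 2 \<le> card H"
    hence fin: "finite H" using assms finite_subset by blast
    have "card {fball F y \<rho> \<inter> H | y \<rho>. y \<in> X \<and> 0 \<le> \<rho>} \<le> card (Pow H)"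
      using fin by (intro card_mono) auto
    also have "\<dots> = 2 ^ card H" using fin by (simp add: card_Pow)
    also have "\<dots> \<le> card H ^ card H" using H by (intro power_mono) auto
    also have "\<dots> \<le> card H ^ max 1 (card F)"
      using H assms card_mono[of F H] by (intro power_increasing) auto
    finally show "card {fball F y \<rho> \<inter> H | y \<rho>. y \<in> X \<and> 0 \<le> \<rho>} \<le> card H ^ max 1 (card F)" .
  qed auto
  from LeastI[of "\<lambda>s. 1 \<le> s \<and> (\<forall>H. H \<subseteq> F \<and> 2 \<le> card H \<longrightarrow>
        card {fball F y \<rho> \<inter> H | y \<rho>. y \<in> X \<and> 0 \<le> \<rho>} \<le> card H ^ s)", OF this]
  show "1 \<le> sdim X F" "\<And>H. H \<subseteq> F \<Longrightarrow> 2 \<le> card H \<Longrightarrow>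
        card {fball F y \<rho> \<inter> H | y \<rho>. y \<in> X \<and> 0 \<le> \<rho>} \<le> card H ^ sdim X F"
    unfolding sdim_def[symmetric] by blast+
qed

text \<open>Balls as sets of points rather than of functions, since different points may have equal
  functions \<open>f x\<close>.\<close>

definition ball_traces :: "'a set \<Rightarrow> ('b \<Rightarrow> 'a \<Rightarrow> real) \<Rightarrow> 'b set \<Rightarrow> 'b set set" where
  "ball_traces X f U = {{x \<in> U. f x u \<le> \<rho>} | u \<rho>. u \<in> X \<and> 0 \<le> \<rho>}"

text \<open>These are the sublevel sets of the minimum of \<open>f x u\<close> over \<open>u\<close>
  in \<open>C\<close>; hence one radius for all centers.\<close>

definition union_ranges :: "'a set \<Rightarrow> ('b \<Rightarrow> 'a \<Rightarrow> real) \<Rightarrow> 'b set \<Rightarrow> nat \<Rightarrow> 'b set set" where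
  "union_ranges X f R k = {{x \<in> R. \<exists>u\<in>C. f x u \<le> \<rho>} | C \<rho>.
     C \<subseteq> X \<and> finite C \<and> C \<noteq> {} \<and> card C \<le> k \<and> 0 \<le> \<rho>}"

text \<open>A ball of points is the preimage under \<open>f\<close> of a ball of functions, so
  \<open>sdim\<close> bounds the count when \<open>f\<close> takes at least two values on
  \<open>U\<close>. If \<open>f\<close> is constant on \<open>U\<close>, only the empty set and
  \<open>U\<close> occur, and \<open>2 \<le> N\<close> suffices.\<close>

lemma card_ball_traces_le:
  assumes "finite R" "U \<subseteq> R" "U \<noteq> {}" "card U \<le> N" "2 \<le> N"
  shows "card (ball_traces X f U) \<le> N ^ sdim X (f ` R)"
proof (cases "2 \<le> card (f ` U)")
  case True
  define \<G> where "\<G> = {fball (f ` R) y \<rho> \<inter> f ` U | y \<rho>. y \<in> X \<and> 0 \<le> \<rho>}"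
  have finU: "finite U" using assms finite_subset by blast
  have "finite \<G>"
    by (rule finite_subset[of _ "Pow (f ` U)"]) (use finU in \<open>auto simp: \<G>_def\<close>)
  moreover have "ball_traces X f U \<subseteq> (\<lambda>G. {x \<in> U. f x \<in> G}) ` \<G>"
  proof
    fix T assume "T \<in> ball_traces X f U"
    then obtain u \<rho> where *: "T = {x \<in> U. f x u \<le> \<rho>}" "u \<in> X" "0 \<le> \<rho>"
      by (auto simp: ball_traces_def)
    have "T = {x \<in> U. f x \<in> fball (f ` R) u \<rho> \<inter> f ` U}"
      using assms(2) *(1) by (auto simp: fball_def)
    thus "T \<in> (\<lambda>G. {x \<in> U. f x \<in> G}) ` \<G>" using *(2,3) unfolding \<G>_def by blast
  qed
  ultimately have "card (ball_traces X f U) \<le> card \<G>" by (rule surj_card_le)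
  also have "\<dots> \<le> card (f ` U) ^ sdim X (f ` R)"
    unfolding \<G>_def using assms True by (intro card_fball_traces_le) auto
  also have "\<dots> \<le> N ^ sdim X (f ` R)"
    using card_image_le[OF finU, of f] assms by (intro power_mono) auto
  finally show ?thesis .
next
  case False
  have finU: "finite U" using assms finite_subset by blast
  obtain x0 where x0: "x0 \<in> U" using assms by auto
  have "f x = f x0" if "x \<in> U" for x
  proof (rule ccontr)
    assume "f x \<noteq> f x0"
    hence "card {f x, f x0} = 2" by simp
    moreover have "card {f x, f x0} \<le> card (f ` U)" using that x0 finU by (intro card_mono) auto
    ultimately show False using False by simp
  qed
  hence "ball_traces X f U \<subseteq> {{}, U}" by (auto simp: ball_traces_def)
  hence "card (ball_traces X f U) \<le> card {{}, U}" by (intro card_mono) auto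
  also have "\<dots> \<le> 2 ^ 1" by (simp add: card_insert_if)
  also have "\<dots> \<le> N ^ 1" using assms by simp
  also have "\<dots> \<le> N ^ sdim X (f ` R)"
    using assms sdim_ge_1[of "f ` R" X] by (intro power_increasing) auto
  finally show ?thesis .
qed

text \<open>The trace of a union is determined by a list of \<open>k\<close> ball traces, one per
  center.\<close>

lemma card_union_ranges_traces_le:
  assumes "finite R" "U \<subseteq> R" "U \<noteq> {}" "card U \<le> N" "2 \<le> N"
  shows "card ((\<lambda>A. A \<inter> U) ` union_ranges X f R k) \<le> N ^ (sdim X (f ` R) * k)"
proof -
  have fin: "finite (ball_traces X f U)"
    by (rule finite_subset[of _ "Pow U"])
       (use assms finite_subset in \<open>auto simp: ball_traces_def\<close>)
  have "(\<lambda>A. A \<inter> U) ` union_ranges X f R k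
      \<subseteq> (\<lambda>Ts. \<Union> (set Ts)) ` lists_of_length (ball_traces X f U) k"
  proof
    fix T assume "T \<in> (\<lambda>A. A \<inter> U) ` union_ranges X f R k"
    then obtain C \<rho> where C: "T = {x \<in> R. \<exists>u\<in>C. f x u \<le> \<rho>} \<inter> U" "C \<subseteq> X" "finite C" "C \<noteq> {}"
        "card C \<le> k" "0 \<le> \<rho>"
      by (auto simp: union_ranges_def)
    obtain us where us: "set us = C" "length us = card C"
      using C(3) by (metis distinct_card finite_distinct_list)
    obtain u0 where u0: "u0 \<in> C" using C by auto
    \<comment> \<open>Repeating one center pads the list to length exactly \<open>k\<close> without
      changing the union.\<close>
    define vs where "vs = us @ replicate (k - card C) u0"
    have vs: "set vs = C" "length vs = k" using us u0 C(5) by (auto simp: vs_def)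
    define Ts where "Ts = map (\<lambda>u. {x \<in> U. f x u \<le> \<rho>}) vs"
    have "Ts \<in> lists_of_length (ball_traces X f U) k"
      using vs C by (auto simp: Ts_def lists_of_length_def ball_traces_def)
    moreover have "T = \<Union> (set Ts)"
      using vs C(1) assms(2) by (auto simp: Ts_def)
    ultimately show "T \<in> (\<lambda>Ts. \<Union> (set Ts)) ` lists_of_length (ball_traces X f U) k" by blast
  qed
  hence "card ((\<lambda>A. A \<inter> U) ` union_ranges X f R k) \<le> card (lists_of_length (ball_traces X f U) k)"
    using fin by (intro surj_card_le) auto
  also have "\<dots> = card (ball_traces X f U) ^ k" using fin by (rule card_lists_of_length)
  also have "\<dots> \<le> (N ^ sdim X (f ` R)) ^ k" by (intro power_mono card_ball_traces_le assms) auto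
  finally show ?thesis by (simp add: power_mult)
qed

section \<open>The tail bound and the sample size it requires\<close>

lemma prob_uniform_deviation_ge:
  fixes \<eta> :: real
  assumes R: "finite R" "R \<noteq> {}" and m: "m \<ge> 1" and \<eta>: "\<eta> > 0"
  shows "measure_pmf.prob (replicate_pmf m (pmf_of_set R))
     {xs. \<forall>A\<in>union_ranges X f R k. \<bar>hits A xs / real m - real (card A) / real (card R)\<bar> \<le> \<eta>}
     \<ge> 1 - 2 * (2 * real m) ^ (sdim X (f ` R) * k) * exp (- (real m * \<eta>\<^sup>2 / 2))"
proof -
  let ?M = "replicate_pmf m (pmf_of_set R)"
  define P where "P = (2 * real m) ^ (sdim X (f ` R) * k)"
  \<comment> \<open>With threshold \<open>m * \<bar>l\<bar> * \<eta>\<close> the exponent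
    \<open>l\<^sup>2 / 2 * m - m * \<bar>l\<bar> * \<eta>\<close> is least at
    \<open>\<bar>l\<bar> = \<eta>\<close>. The two signs of \<open>l\<close> cover deviations
    upwards and downwards.\<close>
  define B where "B l = {xs. \<exists>A\<in>union_ranges X f R k.
      real m * \<eta>\<^sup>2 \<le> l * (hits A xs - real m * (real (card A) / real (card R)))}" for l :: real
  have B: "measure_pmf.prob ?M (B l) \<le> P * exp (- (real m * \<eta>\<^sup>2 / 2))" if "l\<^sup>2 = \<eta>\<^sup>2" for l
  proof -
    have "measure_pmf.prob ?M (B l) \<le> P * exp (l\<^sup>2 / 2 * real m - real m * \<eta>\<^sup>2)"
      unfolding B_def
    proof (rule prob_exists_large_deviation_le[OF R _ _ m])
      fix U assume "U \<subseteq> R" "U \<noteq> {}" "card U \<le> 2 * m"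
      hence "card ((\<lambda>A. A \<inter> U) ` union_ranges X f R k) \<le> (2 * m) ^ (sdim X (f ` R) * k)"
        using m R by (intro card_union_ranges_traces_le) auto
      hence "real (card ((\<lambda>A. A \<inter> U) ` union_ranges X f R k)) \<le> real ((2 * m) ^ (sdim X (f ` R) * k))"
        by (rule of_nat_mono)
      thus "real (card ((\<lambda>A. A \<inter> U) ` union_ranges X f R k)) \<le> P" by (simp add: P_def)
    qed (auto simp: union_ranges_def)
    thus ?thesis by (simp add: that)
  qed
  define S where "S = {xs. \<forall>A\<in>union_ranges X f R k.
    \<bar>hits A xs / real m - real (card A) / real (card R)\<bar> \<le> \<eta>}"
  have "- S \<subseteq> B \<eta> \<union> B (- \<eta>)"
  proof
    fix xs assume "xs \<in> - S"
    then obtain A where A: "A \<in> union_ranges X f R k"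
      and dev: "\<bar>hits A xs / real m - real (card A) / real (card R)\<bar> > \<eta>" by (auto simp: S_def)
    define v where "v = hits A xs - real m * (real (card A) / real (card R))"
    have "v = real m * (hits A xs / real m - real (card A) / real (card R))"
      using m by (simp add: v_def field_simps)
    hence "\<bar>v\<bar> \<ge> real m * \<eta>" using dev m by (simp add: abs_mult)
    hence "\<eta> * \<bar>v\<bar> \<ge> \<eta> * (real m * \<eta>)" using \<eta> by (intro mult_left_mono) auto
    hence "real m * \<eta>\<^sup>2 \<le> \<eta> * v \<or> real m * \<eta>\<^sup>2 \<le> (- \<eta>) * v"
      by (auto simp: abs_if power2_eq_square mult_ac split: if_splits)
    thus "xs \<in> B \<eta> \<union> B (- \<eta>)" using A unfolding B_def v_def by blast
  qed
  hence "measure_pmf.prob ?M (- S) \<le> measure_pmf.prob ?M (B \<eta> \<union> B (- \<eta>))"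
    by (intro measure_pmf.finite_measure_mono) auto
  also have "\<dots> \<le> measure_pmf.prob ?M (B \<eta>) + measure_pmf.prob ?M (B (- \<eta>))"
    by (intro measure_subadditive) auto
  also have "\<dots> \<le> 2 * P * exp (- (real m * \<eta>\<^sup>2 / 2))"
    using B[of \<eta>] B[of "- \<eta>"] by simp
  finally show ?thesis
    using measure_pmf.prob_compl[of S ?M] by (simp add: P_def S_def Compl_eq_Diff_UNIV)
qed

text \<open>Taking logarithms, \<open>m * \<epsilon>\<^sup>2 / 288\<close> has to exceed
  \<open>ln 2 + t * ln (2 * m) + ln (1 / \<delta>)\<close>, where \<open>m\<close> occurs on both
  sides. Half of the left side absorbs the growth of \<open>ln (2 * m)\<close>; the other half pays
  for what does not depend on \<open>m\<close>.\<close>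

lemma sample_size_suffices:
  fixes \<epsilon> \<delta> :: real
  assumes "k \<ge> 1" "s \<ge> 1" "0 < \<epsilon>" "\<epsilon> < 1" "0 < \<delta>" "\<delta> < 1"
    and m: "real m \<ge> sample_size (576 * (ln 1152 + 4)) 1 \<epsilon> \<delta> k s"
  shows "m \<ge> 1" "2 * (2 * real m) ^ (s * k) * exp (- (real m * (\<epsilon> / 12)\<^sup>2 / 2)) \<le> \<delta>"
proof -
  define t where "t = real k * real s"
  define \<Lambda> where "\<Lambda> = 1 + ln (t / \<epsilon>)"
  define M where "M = max 1 (ln (1 / \<delta>))"
  have "1 * 1 \<le> t" unfolding t_def using assms by (intro mult_mono) auto
  hence t: "t \<ge> 1" by simp
  hence \<Lambda>: "\<Lambda> \<ge> 1" using assms by (simp add: \<Lambda>_def field_simps)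
  have M: "M \<ge> 1" "ln (1 / \<delta>) \<le> M" by (auto simp: M_def)
  have "t * 1 \<le> t * \<Lambda>" using t \<Lambda> by (intro mult_left_mono) auto
  moreover have "t * \<Lambda> * 1 \<le> t * \<Lambda> * M" using t \<Lambda> M by (intro mult_left_mono) auto
  moreover have "1 * M \<le> t * \<Lambda> * M"
    using t \<Lambda> M mult_mono[of 1 t 1 \<Lambda>] by (intro mult_right_mono) auto
  \<comment> \<open>The product \<open>t * \<Lambda> * M\<close> of factors at least 1 dominates
    each of the separate error terms.\<close>
  ultimately have Q: "t * \<Lambda> \<le> t * \<Lambda> * M" "M \<le> t * \<Lambda> * M" "1 \<le> t * \<Lambda> * M"
    using t M by linarith+
  have "real m \<ge> 576 * (ln 1152 + 4) * (t * \<Lambda> * M) / \<epsilon>\<^sup>2"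
    using m by (simp add: sample_size_def t_def \<Lambda>_def M_def mult_ac)
  hence m1: "real m * \<epsilon>\<^sup>2 / 576 \<ge> (ln 1152 + 4) * (t * \<Lambda> * M)"
    using assms by (simp add: field_simps)
  have ln0: "ln (1152::real) > 0" by simp
  have "(ln 1152 + 4) * (t * \<Lambda> * M) > 0" using ln0 Q by (intro mult_pos_pos[of "ln 1152 + 4"]) linarith+
  with m1 have "real m * \<epsilon>\<^sup>2 / 576 > 0" by linarith
  hence mpos: "m > 0" by (auto intro!: Nat.gr0I)
  thus "m \<ge> 1" by simp
  \<comment> \<open>The concave function \<open>ln\<close> is bounded by its tangent at
    \<open>w\<close>, chosen so that \<open>t * (2 * m / w)\<close> is exactly
    \<open>m * \<epsilon>\<^sup>2 / 576\<close>.\<close>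
  define w where "w = 1152 * t / \<epsilon>\<^sup>2"
  have w: "w > 0" using t assms by (simp add: w_def)
  have "ln (2 * real m) = ln (2 * real m / w) + ln w"
    using mpos w by (simp add: ln_div)
  also have "ln (2 * real m / w) \<le> 2 * real m / w - 1"
    using mpos w by (intro ln_le_minus_one) auto
  finally have "t * ln (2 * real m) \<le> t * (2 * real m / w + ln w)"
    using t by (intro mult_left_mono) auto
  also have "\<dots> = real m * \<epsilon>\<^sup>2 / 576 + t * ln w"
    using t assms by (simp add: w_def field_simps)
  also have "ln w = ln 1152 + ln t - 2 * ln \<epsilon>"
    using t assms by (simp add: w_def ln_div ln_mult ln_realpow)
  also have "\<dots> \<le> ln 1152 + 2 * (ln t - ln \<epsilon>)"
    using t by simp
  also have "ln 1152 \<le> ln 1152 * \<Lambda>"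
    using mult_left_mono[OF \<Lambda>, of "ln 1152"] ln0 by simp
  also have "ln t - ln \<epsilon> \<le> \<Lambda>"
    using t assms by (simp add: \<Lambda>_def ln_div)
  finally have 1: "t * ln (2 * real m) \<le> real m * \<epsilon>\<^sup>2 / 576 + (ln 1152 + 2) * (t * \<Lambda>)"
    using t by (simp add: algebra_simps)
  have "(ln 1152 + 2) * (t * \<Lambda>) \<le> (ln 1152 + 2) * (t * \<Lambda> * M)"
    using Q ln0 by (intro mult_left_mono) auto
  moreover have "ln (2::real) \<le> 1" using ln_le_minus_one[of "2::real"] by simp
  \<comment> \<open>The constant 4 is 2 from \<open>ln w\<close>, 1 for \<open>ln 2\<close> and 1
    for \<open>ln (1 / \<delta>)\<close>.\<close>
  moreover have "(ln 1152 + 4) * (t * \<Lambda> * M) = (ln 1152 + 2) * (t * \<Lambda> * M) + 2 * (t * \<Lambda> * M)"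
    by (simp add: algebra_simps)
  ultimately have "ln 2 + t * ln (2 * real m) + ln (1 / \<delta>)
      \<le> real m * \<epsilon>\<^sup>2 / 576 + (ln 1152 + 4) * (t * \<Lambda> * M)"
    using 1 Q M by linarith
  also have "\<dots> \<le> real m * \<epsilon>\<^sup>2 / 288" using m1 by simp
  finally have fin: "ln 2 + t * ln (2 * real m) - real m * (\<epsilon> / 12)\<^sup>2 / 2 \<le> ln \<delta>"
    using assms by (simp add: ln_div power_divide)
  have "2 * (2 * real m) ^ (s * k) * exp (- (real m * (\<epsilon> / 12)\<^sup>2 / 2))
      = exp (ln 2 + t * ln (2 * real m) - real m * (\<epsilon> / 12)\<^sup>2 / 2)"
  proof -
    have "(2 * real m) ^ (s * k) = exp (ln ((2 * real m) ^ (s * k)))" using mpos by simp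
    also have "\<dots> = exp (t * ln (2 * real m))"
      using mpos by (subst ln_realpow) (simp_all add: t_def mult_ac)
    finally have pow: "(2 * real m) ^ (s * k) = exp (t * ln (2 * real m))" .
    show ?thesis unfolding pow by (simp add: exp_add exp_diff exp_minus inverse_eq_divide)
  qed
  also have "\<dots> \<le> exp (ln \<delta>)" using fin by simp
  finally show "2 * (2 * real m) ^ (s * k) * exp (- (real m * (\<epsilon> / 12)\<^sup>2 / 2)) \<le> \<delta>"
    using assms by simp
qed

subsection \<open>From uniform deviation to coresets\<close>

text \<open>Layer-cake formula: the sum of the c x * (b - g x) is the integral over t in [a, b] of the
  total weight of the sublevel set of g at t.\<close>
lemma abs_weighted_sum_le_of_sublevels:
  fixes c g :: "'a \<Rightarrow> real"
  assumes R: "finite R" and c0: "(\<Sum>x\<in>R. c x) = 0" and ab: "a \<le> b"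
    and g: "\<And>x. x \<in> R \<Longrightarrow> a \<le> g x \<and> g x \<le> b"
    and dev: "\<And>t. a \<le> t \<Longrightarrow> t \<le> b \<Longrightarrow> \<bar>\<Sum>x\<in>{x \<in> R. g x \<le> t}. c x\<bar> \<le> \<eta>"
  shows "\<bar>\<Sum>x\<in>R. c x * g x\<bar> \<le> \<eta> * (b - a)"
proof -
  have ind: "((\<lambda>t. c x * of_bool (g x \<le> t)) has_integral c x * (b - g x)) {a..b}" if "x \<in> R" for x
  proof -
    have "((\<lambda>t. 1::real) has_integral (b - g x)) {g x..b}"
      using has_integral_const_real[of "1::real" "g x" b] g[OF that] by simp
    hence "((\<lambda>t. if t \<in> {g x..b} then 1 else 0::real) has_integral (b - g x)) {a..b}"
      using g[OF that] by (subst has_integral_restrict) auto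
    hence "((\<lambda>t. of_bool (g x \<le> t)) has_integral (b - g x)) {a..b}"
      by (rule has_integral_eq[rotated]) auto
    thus ?thesis by (rule has_integral_mult_right)
  qed
  have "((\<lambda>t. \<Sum>x\<in>R. c x * of_bool (g x \<le> t)) has_integral (\<Sum>x\<in>R. c x * (b - g x))) {a..b}"
    using R ind by (intro has_integral_sum) auto
  moreover have "(\<Sum>x\<in>R. c x * of_bool (g x \<le> t)) = (\<Sum>x\<in>{x \<in> R. g x \<le> t}. c x)" for t
    using R by (intro sum.mono_neutral_cong_right) auto
  \<comment> \<open>Total weight zero removes the contribution of the constant
    \<open>b\<close>.\<close>
  moreover have "(\<Sum>x\<in>R. c x * (b - g x)) = - (\<Sum>x\<in>R. c x * g x)"
    using c0 by (simp add: algebra_simps sum_subtractf flip: sum_distrib_left)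
  ultimately have int: "((\<lambda>t. \<Sum>x\<in>{x \<in> R. g x \<le> t}. c x) has_integral - (\<Sum>x\<in>R. c x * g x)) {a..b}"
    by simp
  have "\<eta> \<ge> 0" using dev[of a] ab by simp
  with has_integral_bound[of \<eta> _ _ a b] int dev
  have "norm (- (\<Sum>x\<in>R. c x * g x)) \<le> \<eta> * measure lborel {a..b}"
    by (metis (no_types, lifting) atLeastAtMost_iff box_real(2) real_norm_def)
  thus ?thesis using ab by simp
qed

text \<open>Deviations are controlled only for sublevel sets of \<open>G\<close>, while the costs
  involve \<open>D\<close>. Sandwiching \<open>G\<close> between \<open>D\<close> and
  \<open>q * D\<close> transfers the bound at the price of a multiplicative error.\<close>

lemma weighted_sum_diff_le:
  fixes v w D G :: "'a \<Rightarrow> real"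
  assumes R: "finite R" and ab: "a \<le> b" and q: "q \<ge> 1"
    and v: "\<And>x. x \<in> R \<Longrightarrow> v x \<ge> 0" and w: "\<And>x. x \<in> R \<Longrightarrow> w x \<ge> 0"
    and vw: "(\<Sum>x\<in>R. v x) = (\<Sum>x\<in>R. w x)"
    and D: "\<And>x. x \<in> R \<Longrightarrow> D x \<le> G x \<and> G x \<le> q * D x"
    and G: "\<And>x. x \<in> R \<Longrightarrow> a \<le> G x \<and> G x \<le> b"
    and dev: "\<And>t. a \<le> t \<Longrightarrow> t \<le> b \<Longrightarrow>
      \<bar>(\<Sum>x\<in>{x \<in> R. G x \<le> t}. w x) - (\<Sum>x\<in>{x \<in> R. G x \<le> t}. v x)\<bar> \<le> \<eta>"
  shows "\<bar>(\<Sum>x\<in>R. v x * D x) - (\<Sum>x\<in>R. w x * D x)\<bar> \<le> (q - 1) * (\<Sum>x\<in>R. v x * D x) + \<eta> * (b - a)"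
proof -
  have "\<bar>\<Sum>x\<in>R. (w x - v x) * G x\<bar> \<le> \<eta> * (b - a)"
    by (rule abs_weighted_sum_le_of_sublevels[OF R _ ab G])
       (use vw dev in \<open>simp_all add: sum_subtractf\<close>)
  hence dG: "\<bar>(\<Sum>x\<in>R. w x * G x) - (\<Sum>x\<in>R. v x * G x)\<bar> \<le> \<eta> * (b - a)"
    by (simp add: algebra_simps sum_subtractf)
  have DG: "(\<Sum>x\<in>R. u x * D x) \<le> (\<Sum>x\<in>R. u x * G x)"
           "(\<Sum>x\<in>R. u x * G x) \<le> q * (\<Sum>x\<in>R. u x * D x)" if "\<And>x. x \<in> R \<Longrightarrow> u x \<ge> 0" for u
  proof -
    show "(\<Sum>x\<in>R. u x * D x) \<le> (\<Sum>x\<in>R. u x * G x)"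
      using D that by (intro sum_mono mult_left_mono) auto
    have "(\<Sum>x\<in>R. u x * G x) \<le> (\<Sum>x\<in>R. u x * (q * D x))"
      using D that by (intro sum_mono mult_left_mono) auto
    thus "(\<Sum>x\<in>R. u x * G x) \<le> q * (\<Sum>x\<in>R. u x * D x)"
      by (simp add: sum_distrib_left mult_ac)
  qed
  define P P' where "P = (\<Sum>x\<in>R. v x * D x)" and "P' = (\<Sum>x\<in>R. w x * D x)"
  have 1: "P' \<le> q * P + \<eta> * (b - a)" "P \<le> q * P' + \<eta> * (b - a)"
    using dG DG[of v, OF v] DG[of w, OF w] by (auto simp: P_def P'_def)
  show ?thesis
  \<comment> \<open>The multiplicative error is charged to the smaller of the two averages, hence is
    at most \<open>(q - 1) * P\<close>; no further constant is lost.\<close>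
  proof (cases "P' \<ge> P")
    case True
    thus ?thesis using 1 unfolding P_def[symmetric] P'_def[symmetric] by (simp add: algebra_simps)
  next
    case False
    hence "(q - 1) * P' \<le> (q - 1) * P" using q by (intro mult_left_mono) auto
    thus ?thesis using 1 False unfolding P_def[symmetric] P'_def[symmetric]
      by (simp add: algebra_simps)
  qed
qed

lemma sum_list_eq_sum_count_list:
  fixes g :: "'a \<Rightarrow> real"
  assumes "finite R" "set xs \<subseteq> R"
  shows "(\<Sum>x\<leftarrow>xs. g x) = (\<Sum>x\<in>R. real (count_list xs x) * g x)"
  using assms(2)
proof (induction xs)
  case (Cons y ys)
  have "(\<Sum>x\<in>R. real (count_list (y # ys) x) * g x)
      = (\<Sum>x\<in>R. (if x = y then g x else 0) + real (count_list ys x) * g x)"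
    by (intro sum.cong) (auto simp: algebra_simps)
  also have "\<dots> = g y + (\<Sum>x\<in>R. real (count_list ys x) * g x)"
    using assms(1) Cons.prems by (simp add: sum.distrib)
  finally show ?case using Cons by simp
qed simp

text \<open>By convexity the power function lies below its chord between 1 and 2.\<close>

lemma powr_one_plus_le:
  fixes \<epsilon> z :: real
  assumes "z \<ge> 1" "0 < \<epsilon>" "\<epsilon> < 1"
  shows "(1 + \<epsilon>) powr z \<le> 1 + 2 powr z * \<epsilon>"
proof -
  have "((1 - \<epsilon>) *\<^sub>R 1 + \<epsilon> *\<^sub>R 2) powr z \<le> (1 - \<epsilon>) * (1 powr z) + \<epsilon> * (2 powr z)"
    using assms by (intro convex_onD[OF powr_convex]) auto
  thus ?thesis using assms by (simp add: algebra_simps)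
qed

text \<open>The deterministic half of the argument. \<open>P\<close>, \<open>P'\<close> and
  \<open>a0\<close> are the three costs divided by \<open>card R\<close>, so that both weightings
  have total mass 1; the factor is restored at the end.\<close>

lemma is_coreset_of_small_deviation:
  fixes z \<epsilon> r :: real
  assumes metric: "Metric_space X d" and cX: "c \<in> X" and r: "r > 0" and \<epsilon>: "0 < \<epsilon>" "\<epsilon> < 1"
    and R: "R \<subseteq> ring_in X d c r (2 * r)" "finite R" "R \<noteq> {}" and z: "z \<ge> 1"
    and f: "\<forall>x\<in>R. \<forall>y\<in>X. 0 \<le> f x y \<and> d x y \<le> f x y \<and> f x y \<le> (1 + \<epsilon>) * d x y"
    and xs: "set xs \<subseteq> R" "xs \<noteq> []"
    and dev: "\<forall>A\<in>union_ranges X f R k.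
      \<bar>hits A xs / real (length xs) - real (card A) / real (card R)\<bar> \<le> \<epsilon> / 12"
  shows "is_coreset X d k z ((if z = 1 then 1 else 2 powr z + 10 powr z) * \<epsilon>)
    (cost d z R unit_weight {c}) R (set xs) (sample_weight R xs)"
  unfolding is_coreset_def
proof (intro allI impI, elim conjE)
  fix C assume C: "C \<subseteq> X" "finite C" "C \<noteq> {}" "card C \<le> k"
  interpret Metric_space X d by (rule metric)
  define \<Gamma> where "\<Gamma> = (if z = 1 then 1 else 2 powr z + 10 powr z)"
  define n where "n = real (card R)"
  define m where "m = real (length xs)"
  have n: "n > 0" using R by (simp add: n_def card_gt_0_iff)
  have m: "m > 0" using xs by (simp add: m_def)
  define D where "D x = Min ((\<lambda>u. d x u powr z) ` C)" for x
  define G where "G x = Min ((\<lambda>u. f x u powr z) ` C)" for x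
  define v where "v x = 1 / n" for x :: 'a
  define w where "w x = real (count_list xs x) / m" for x
  have Dle: "D x \<le> d x u powr z" if "u \<in> C" for x u
    unfolding D_def using C that by (intro Min_le) auto
  have Dge: "y \<le> D x" if "\<And>u. u \<in> C \<Longrightarrow> y \<le> d x u powr z" for x y
    unfolding D_def using C that by (intro Min.boundedI) auto
  have Gle: "G x \<le> f x u powr z" if "u \<in> C" for x u
    unfolding G_def using C that by (intro Min_le) auto
  have Gge: "y \<le> G x" if "\<And>u. u \<in> C \<Longrightarrow> y \<le> f x u powr z" for x y
    unfolding G_def using C that by (intro Min.boundedI) auto
  have G_attained: "\<exists>u\<in>C. G x = f x u powr z" for x
    using Min_in[of "(\<lambda>u. f x u powr z) ` C"] C unfolding G_def by blast
  have D_attained: "\<exists>u\<in>C. D x = d x u powr z" for x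
    using Min_in[of "(\<lambda>u. d x u powr z) ` C"] C unfolding D_def by blast
  have fX: "0 \<le> f x u" "d x u \<le> f x u" "f x u \<le> (1 + \<epsilon>) * d x u" if "x \<in> R" "u \<in> C" for x u
    using f that C by blast+
  have RX: "x \<in> X" "r < d x c" "d x c \<le> 2 * r" if "x \<in> R" for x
    using R that by (auto simp: ring_in_def)
  define q where "q = (1 + \<epsilon>) powr z"
  have q: "q \<ge> 1" using \<epsilon> z by (simp add: q_def ge_one_powr_ge_zero)
  have DG: "D x \<le> G x \<and> G x \<le> q * D x" if x: "x \<in> R" for x
  proof
    obtain u where u: "u \<in> C" "G x = f x u powr z" using G_attained by blast
    have "D x \<le> d x u powr z" by (rule Dle[OF u(1)])
    also have "\<dots> \<le> G x" unfolding u(2) using fX[OF x u(1)] z by (intro powr_mono2) auto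
    finally show "D x \<le> G x" .
    obtain u' where u': "u' \<in> C" "D x = d x u' powr z" using D_attained by blast
    have "G x \<le> f x u' powr z" by (rule Gle[OF u'(1)])
    also have "\<dots> \<le> ((1 + \<epsilon>) * d x u') powr z" using fX[OF x u'(1)] z by (intro powr_mono2) auto
    also have "\<dots> = q * D x" using \<epsilon> by (simp add: u'(2) q_def powr_mult)
    finally show "G x \<le> q * D x" .
  qed
  define E where "E = Min (d c ` C)"
  obtain u0 where u0: "u0 \<in> C" "E = d c u0"
    using Min_in[of "d c ` C"] C unfolding E_def by blast
  have E_le: "E \<le> d c u" if "u \<in> C" for u unfolding E_def using C that by (intro Min_le) auto
  have E0: "E \<ge> 0" using u0 by simp
  \<comment> \<open>Bounds from the triangle inequality through \<open>c\<close>. Truncation at 0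
    keeps powers monotone, and the factor \<open>1 + \<epsilon>\<close> in \<open>b\<close> accounts
    for passing from \<open>d\<close> to \<open>f\<close>.\<close>
  define a where "a = max 0 (E - 2 * r)"
  define b where "b = (1 + \<epsilon>) * (E + 2 * r)"
  have d_ge: "a \<le> d x u" if "x \<in> R" "u \<in> C" for x u
    using triangle[of c x u] E_le[OF that(2)] RX[OF that(1)] cX C that(2) commute[of c x]
    by (auto simp: a_def)
  have d_le: "d x u0 \<le> E + 2 * r" if "x \<in> R" for x
    using triangle[of x c u0] RX[OF that] u0 cX C by auto
  have a_nonneg: "a \<ge> 0" by (simp add: a_def)
  have D_ge: "a powr z \<le> D x" if "x \<in> R" for x
    using d_ge[OF that] a_nonneg z by (intro Dge powr_mono2) auto
  have D_le: "D x \<le> (E + 2 * r) powr z" if "x \<in> R" for x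
    using Dle[OF u0(1), of x] d_le[OF that] z powr_mono2[of z "d x u0" "E + 2 * r"] by simp
  have G_bounds: "a powr z \<le> G x \<and> G x \<le> b powr z" if x: "x \<in> R" for x
  proof
    show "a powr z \<le> G x" using D_ge[OF x] DG[OF x] by simp
    have "G x \<le> q * D x" using DG[OF x] by simp
    also have "\<dots> \<le> q * (E + 2 * r) powr z" using D_le[OF x] q by (intro mult_left_mono) auto
    also have "\<dots> = b powr z" using \<epsilon> E0 r by (simp add: q_def b_def powr_mult)
    finally show "G x \<le> b powr z" .
  qed
  have ab: "a powr z \<le> b powr z"
    using G_bounds R(3) by (meson all_not_in_conv order_trans)
  have count: "(\<Sum>x\<in>R. w x * g x) = (\<Sum>x\<leftarrow>xs. g x) / m" for g
    using sum_list_eq_sum_count_list[OF R(2) xs(1), of g] by (simp add: w_def sum_divide_distrib)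
  have sumv: "(\<Sum>x\<in>R. v x) = 1" using n by (simp add: v_def n_def)
  have sumw: "(\<Sum>x\<in>R. w x) = 1"
    using count[of "\<lambda>_. 1"] m by (simp add: m_def sum_list_triv)
  have w0: "w x \<ge> 0" and v0: "v x \<ge> 0" for x using m n by (simp_all add: w_def v_def)
  have sublevels: "\<bar>(\<Sum>x\<in>{x \<in> R. G x \<le> t}. w x) - (\<Sum>x\<in>{x \<in> R. G x \<le> t}. v x)\<bar> \<le> \<epsilon> / 12"
    if t: "a powr z \<le> t" for t
  proof -
    have t0: "t \<ge> 0" using t order_trans[OF powr_ge_zero] by blast
    define A where "A = {x \<in> R. G x \<le> t}"
    \<comment> \<open>A sublevel set of the \<open>z\<close>-th powers is a union of balls of radius
      \<open>t powr (1 / z)\<close>, so \<open>dev\<close> applies to it.\<close>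
    have "G x \<le> t \<longleftrightarrow> (\<exists>u\<in>C. f x u \<le> t powr (1 / z))" if x: "x \<in> R" for x
    proof
      assume *: "G x \<le> t"
      obtain u where u: "u \<in> C" "G x = f x u powr z" using G_attained by blast
      have "f x u = (f x u powr z) powr (1 / z)" using fX[OF x u(1)] z by (simp add: powr_powr)
      also have "\<dots> \<le> t powr (1 / z)" using * u z by (intro powr_mono2) auto
      finally show "\<exists>u\<in>C. f x u \<le> t powr (1 / z)" using u by blast
    next
      assume "\<exists>u\<in>C. f x u \<le> t powr (1 / z)"
      then obtain u where u: "u \<in> C" "f x u \<le> t powr (1 / z)" by blast
      have "G x \<le> f x u powr z" by (rule Gle[OF u(1)])
      also have "\<dots> \<le> (t powr (1 / z)) powr z" using u fX[OF x u(1)] z by (intro powr_mono2) auto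
      also have "\<dots> = t" using t0 z by (simp add: powr_powr)
      finally show "G x \<le> t" .
    qed
    hence "A = {x \<in> R. \<exists>u\<in>C. f x u \<le> t powr (1 / z)}" by (auto simp: A_def)
    hence "A \<in> union_ranges X f R k"
      using C by (auto simp: union_ranges_def intro!: exI[of _ C] exI[of _ "t powr (1 / z)"])
    hence "\<bar>hits A xs / m - real (card A) / n\<bar> \<le> \<epsilon> / 12" using dev by (simp add: m_def n_def)
    moreover have "(\<Sum>x\<in>A. w x) = hits A xs / m"
    proof -
      have "(\<Sum>x\<in>A. w x) = (\<Sum>x\<in>R. w x * indicat_real A x)"
        using R by (intro sum.mono_neutral_cong_left) (auto simp: A_def)
      thus ?thesis using count[of "indicat_real A"] by (simp add: hits_def)
    qed
    moreover have "(\<Sum>x\<in>A. v x) = real (card A) / n" by (simp add: v_def)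
    ultimately show ?thesis by (simp add: A_def)
  qed
  define P where "P = (\<Sum>x\<in>R. v x * D x)"
  define P' where "P' = (\<Sum>x\<in>R. w x * D x)"
  define a0 where "a0 = (\<Sum>x\<in>R. v x * d x c powr z)"
  have main: "\<bar>P - P'\<bar> \<le> (q - 1) * P + \<epsilon> / 12 * (b powr z - a powr z)"
    unfolding P_def P'_def
    using sumv sumw
    by (intro weighted_sum_diff_le[OF R(2) ab q v0 w0 _ DG G_bounds sublevels]) simp_all
  have avg: "l \<le> (\<Sum>x\<in>R. u x * g x) \<and> (\<Sum>x\<in>R. u x * g x) \<le> h"
    if "\<And>x. u x \<ge> 0" "(\<Sum>x\<in>R. u x) = 1" "\<And>x. x \<in> R \<Longrightarrow> l \<le> g x \<and> g x \<le> h"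
    for u g :: "'a \<Rightarrow> real" and l h
  proof -
    have "(\<Sum>x\<in>R. u x * l) \<le> (\<Sum>x\<in>R. u x * g x)"
      using that by (intro sum_mono mult_left_mono) auto
    moreover have "(\<Sum>x\<in>R. u x * g x) \<le> (\<Sum>x\<in>R. u x * h)"
      using that by (intro sum_mono mult_left_mono) auto
    ultimately show ?thesis using that(2) by (simp flip: sum_distrib_right)
  qed
  have a0_ge: "r powr z \<le> a0"
  proof -
    have "r powr z \<le> d x c powr z \<and> d x c powr z \<le> (2 * r) powr z" if "x \<in> R" for x
      using RX[OF that] r z by (intro conjI powr_mono2) auto
    from avg[OF v0 sumv this] show ?thesis by (simp add: a0_def)
  qed
  have P_bounds: "a powr z \<le> P" "P \<le> (E + 2 * r) powr z"
    and P'_bounds: "a powr z \<le> P'" "P' \<le> (E + 2 * r) powr z"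
    unfolding P_def P'_def
    using avg[OF v0 sumv, of "a powr z" D] avg[OF w0 sumw, of "a powr z" D] D_ge D_le by auto
  have P0: "P \<ge> 0" using P_bounds(1) powr_ge_zero[of a z] by linarith
  have "\<bar>P - P'\<bar> \<le> \<Gamma> * \<epsilon> * (P + a0)"
  proof (cases "z = 1")
    case True
    have [simp]: "E + 2 * r \<ge> 0" "b \<ge> 0" using E0 r \<epsilon> by (auto simp: b_def)
    have a0r: "r \<le> a0" using a0_ge r True by simp
    show ?thesis
    \<comment> \<open>For distant centers both averages lie in an interval of length
      \<open>4 * r\<close>, and \<open>\<epsilon> * P\<close> alone exceeds this; the sampling bound
      is needed only in the other case.\<close>
    proof (cases "\<epsilon> * E \<ge> 6 * r")
      case True': True
      have "1 * E \<ge> \<epsilon> * E" using \<epsilon> E0 by (intro mult_right_mono) auto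
      hence aE: "a = E - 2 * r" using True' r by (simp add: a_def)
      have "\<bar>P - P'\<bar> \<le> 4 * r"
        using P_bounds P'_bounds True aE a_nonneg by simp
      also have "\<dots> \<le> 6 * r - \<epsilon> * (2 * r)" using \<epsilon> r by simp
      also have "\<dots> \<le> \<epsilon> * (E - 2 * r)" using True' by (simp add: algebra_simps)
      also have "\<dots> \<le> \<epsilon> * (P + a0)"
        using \<epsilon> P_bounds(1) a0r r aE True a_nonneg by (intro mult_left_mono) auto
      finally show ?thesis using True by (simp add: \<Gamma>_def)
    next
      case False
      have "b - a \<le> 4 * r + \<epsilon> * E + \<epsilon> * (2 * r)" by (simp add: a_def b_def algebra_simps)
      moreover have "\<epsilon> * (2 * r) \<le> 1 * (2 * r)" using \<epsilon> r by (intro mult_right_mono) auto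
      \<comment> \<open>Here 12 is 4 + 6 + 2, which is why the deviation was taken to be
        \<open>\<epsilon> / 12\<close>.\<close>
      ultimately have "b - a \<le> 12 * r" using False by simp
      hence "\<epsilon> / 12 * (b - a) \<le> \<epsilon> / 12 * (12 * a0)" using \<epsilon> a0r by (intro mult_left_mono) auto
      moreover have "\<bar>P - P'\<bar> \<le> \<epsilon> * P + \<epsilon> / 12 * (b - a)"
        using main True \<epsilon> a_nonneg by (simp add: q_def)
      ultimately have "\<bar>P - P'\<bar> \<le> \<epsilon> * P + \<epsilon> * a0" by simp
      thus ?thesis using True by (simp add: \<Gamma>_def algebra_simps)
    qed
  next
    case False
    \<comment> \<open>Here \<open>b\<close> is compared with the larger of \<open>a\<close> and
      \<open>r\<close>, whose powers are at most \<open>P\<close> and \<open>a0\<close>. This yields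
      the summand \<open>10 powr z\<close> of \<open>\<Gamma>\<close>; the summand
      \<open>2 powr z\<close> comes from \<open>q - 1\<close>.\<close>
    have "b \<le> 2 * (E + 2 * r)" unfolding b_def using \<epsilon> E0 r by (intro mult_right_mono) auto
    also have "\<dots> \<le> 2 * (a + 4 * r)" by (simp add: a_def max_def)
    also have "\<dots> \<le> 10 * max a r" using r by (simp add: max_def)
    finally have "b \<le> 10 * max a r" .
    hence "b powr z \<le> (10 * max a r) powr z"
      using z E0 r \<epsilon> by (intro powr_mono2) (auto simp: b_def)
    also have "\<dots> = 10 powr z * max a r powr z" using r by (simp add: powr_mult)
    also have "\<dots> \<le> 10 powr z * (a powr z + r powr z)"
      by (intro mult_left_mono) (auto simp: max_def)
    also have "\<dots> \<le> 10 powr z * (P + a0)" using P_bounds a0_ge by (intro mult_left_mono) auto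
    finally have "b powr z - a powr z \<le> 10 powr z * (P + a0)" using powr_ge_zero[of a z] by linarith
    moreover have ra: "0 \<le> a0" using a0_ge powr_ge_zero[of r z] by linarith
    ultimately have 1: "\<epsilon> / 12 * (b powr z - a powr z) \<le> \<epsilon> * (10 powr z * (P + a0))"
      using \<epsilon> ab P0 by (intro mult_mono) auto
    have "(q - 1) * P \<le> (2 powr z * \<epsilon>) * (P + a0)"
      using powr_one_plus_le[OF z \<epsilon>] q P0 ra by (intro mult_mono) (auto simp: q_def)
    with 1 main
    have "\<bar>P - P'\<bar> \<le> (2 powr z * \<epsilon>) * (P + a0) + \<epsilon> * (10 powr z * (P + a0))" by linarith
    thus ?thesis using False by (simp add: \<Gamma>_def algebra_simps)
  qed
  hence "n * \<bar>P - P'\<bar> \<le> n * (\<Gamma> * \<epsilon> * (P + a0))" using n by (intro mult_left_mono) auto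
  moreover have "\<bar>n * P - n * P'\<bar> = n * \<bar>P - P'\<bar>"
    using n by (simp add: abs_mult flip: right_diff_distrib)
  ultimately have fin: "\<bar>n * P - n * P'\<bar> \<le> \<Gamma> * \<epsilon> * (n * P + n * a0)"
    by (simp add: algebra_simps)
  have "cost d z R unit_weight C = n * P"
    using n by (simp add: cost_def P_def D_def v_def sum_distrib_left)
  moreover have "cost d z R unit_weight {c} = n * a0"
    using n by (simp add: cost_def a0_def v_def sum_distrib_left)
  moreover have "cost d z (set xs) (sample_weight R xs) C = n * P'"
  proof -
    \<comment> \<open>Points that were not drawn have count 0, so the sum extends to
      \<open>R\<close>.\<close>
    have "cost d z (set xs) (sample_weight R xs) C = (\<Sum>x\<in>R. sample_weight R xs x * D x)"
      unfolding cost_def D_def using R xs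
      by (intro sum.mono_neutral_cong_left) (auto simp: sample_weight_def count_list_0_iff)
    thus ?thesis
      by (simp add: P'_def w_def sum_distrib_left sample_weight_def n_def m_def mult_ac)
  qed
  ultimately show "\<bar>cost d z R unit_weight C - cost d z (set xs) (sample_weight R xs) C\<bar>
      \<le> (if z = 1 then 1 else 2 powr z + 10 powr z) * \<epsilon> *
        (cost d z R unit_weight C + cost d z R unit_weight {c})"
    using fin by (simp add: \<Gamma>_def)
qed

section \<open>Combining the probabilistic and the metric bounds\<close>

lemma prob_sample_is_coreset_ge:
  fixes z \<epsilon> \<delta> r :: real
  assumes metric: "Metric_space X d" and k: "k \<ge> 1" and c: "c \<in> X" and r: "r > 0"
    and \<epsilon>: "0 < \<epsilon>" "\<epsilon> < 1"
    and R: "R \<subseteq> ring_in X d c r (2 * r)" "finite R" "R \<noteq> {}" and z: "z \<ge> 1"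
    and f: "\<forall>x\<in>R. \<forall>y\<in>X. 0 \<le> f x y \<and> d x y \<le> f x y \<and> f x y \<le> (1 + \<epsilon>) * d x y"
    and \<delta>: "0 < \<delta>" "\<delta> < 1"
    and m: "real m \<ge> sample_size (576 * (ln 1152 + 4)) 1 \<epsilon> \<delta> k (sdim X (f ` R))"
  shows "measure_pmf.prob (replicate_pmf m (pmf_of_set R))
      {xs. is_coreset X d k z ((if z = 1 then 1 else 2 powr z + 10 powr z) * \<epsilon>)
        (cost d z R unit_weight {c}) R (set xs) (sample_weight R xs)} \<ge> 1 - \<delta>"
proof -
  let ?M = "replicate_pmf m (pmf_of_set R)"
  define S where "S = {xs. \<forall>A\<in>union_ranges X f R k.
    \<bar>hits A xs / real m - real (card A) / real (card R)\<bar> \<le> \<epsilon> / 12}"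
  have s: "sdim X (f ` R) \<ge> 1" using R by (intro sdim_ge_1) auto
  note size = sample_size_suffices[OF k s \<epsilon> \<delta> m]
  have "1 - \<delta> \<le> measure_pmf.prob ?M S"
    using prob_uniform_deviation_ge[OF R(2,3) size(1), of "\<epsilon> / 12" X f k] size(2) \<epsilon>
    by (simp add: S_def)
  \<comment> \<open>On the support every sample consists of \<open>m\<close> points of
    \<open>R\<close>, as the deterministic bound requires.\<close>
  also have "\<dots> = measure_pmf.prob ?M (S \<inter> set_pmf ?M)"
    by (simp add: measure_Int_set_pmf)
  also have "\<dots> \<le> measure_pmf.prob ?M {xs. is_coreset X d k z ((if z = 1 then 1 else 2 powr z + 10 powr z) * \<epsilon>)
      (cost d z R unit_weight {c}) R (set xs) (sample_weight R xs)}"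
  proof (intro measure_pmf.finite_measure_mono subsetI)
    fix xs assume "xs \<in> S \<inter> set_pmf ?M"
    hence "set xs \<subseteq> R" "length xs = m" "xs \<in> S"
      using R by (auto simp: set_replicate_pmf)
    thus "xs \<in> {xs. is_coreset X d k z ((if z = 1 then 1 else 2 powr z + 10 powr z) * \<epsilon>)
      (cost d z R unit_weight {c}) R (set xs) (sample_weight R xs)}"
      using is_coreset_of_small_deviation[OF metric c r \<epsilon> R z f, of xs k] size(1)
      unfolding S_def by fastforce
  qed auto
  finally show ?thesis .
qed

theorem theorem5p2:
  shows "\<exists>p::nat. \<forall>z::real. z \<ge> 1 \<longrightarrow>
    (\<exists>K \<Gamma> :: real. K > 0 \<and> \<Gamma> \<ge> 1 \<and> (z = 1 \<longrightarrow> \<Gamma> = 1) \<and>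
      (\<forall>(X :: 'a set) (d :: 'a \<Rightarrow> 'a \<Rightarrow> real) (k :: nat) (c :: 'a) (r :: real) (\<epsilon> :: real)
         (R :: 'a set) (f :: 'a \<Rightarrow> 'a \<Rightarrow> real).
        Metric_space X d \<and> k \<ge> 1 \<and> c \<in> X \<and> r > 0 \<and> 0 < \<epsilon> \<and> \<epsilon> < 1 \<and>
        R \<subseteq> ring_in X d c r (2 * r) \<and> finite R \<and> R \<noteq> {} \<and>
        (\<forall>x\<in>R. \<forall>y\<in>X. 0 \<le> f x y \<and> d x y \<le> f x y \<and> f x y \<le> (1 + \<epsilon>) * d x y) \<longrightarrow>
        (\<forall>(\<delta> :: real) (m :: nat).
          0 < \<delta> \<and> \<delta> < 1 \<and> real m \<ge> sample_size K p \<epsilon> \<delta> k (sdim X (f ` R)) \<longrightarrow>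
          measure_pmf.prob (replicate_pmf m (pmf_of_set R))
            {xs. is_coreset X d k z (\<Gamma> * \<epsilon>) (cost d z R unit_weight {c}) R
                   (set xs) (sample_weight R xs)} \<ge> 1 - \<delta>)))"
  (is "\<exists>p. \<forall>z. _ \<longrightarrow> ?Q p z")
\<comment> \<open>A single logarithmic factor suffices, and \<open>K\<close> can be the same for all
  \<open>z\<close>: the exponent affects only \<open>\<Gamma>\<close>.\<close>
proof (rule exI[of _ 1], intro allI impI)
  fix z :: real assume z: "z \<ge> 1"
  define \<Gamma> where "\<Gamma> = (if z = 1 then 1 else 2 powr z + 10 powr z :: real)"
  have K: "576 * (ln 1152 + 4) > (0::real)" by (intro mult_pos_pos add_pos_pos) simp_all
  have \<Gamma>: "\<Gamma> \<ge> 1" "z = 1 \<longrightarrow> \<Gamma> = 1"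
    using z ge_one_powr_ge_zero[of 2 z] powr_ge_zero[of 10 z] by (simp_all add: \<Gamma>_def add_increasing2)
  show "?Q 1 z"
  proof (rule exI[of _ "576 * (ln 1152 + 4)"], rule exI[of _ \<Gamma>], intro conjI allI impI, goal_cases)
    case (4 X d k c r \<epsilon> R f \<delta> m)
    thus ?case
      using prob_sample_is_coreset_ge[of X d k c r \<epsilon> R z f \<delta> m] z unfolding \<Gamma>_def by argo
  qed (use K \<Gamma> in auto)
qed

end
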